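(* For each edit type $\mathrm{edit} \in \{\mathrm{sub}, \mathrm{ins}, \mathrm{del}\}$, $\mathrm{AS}_{\mathrm{edit}}(z_{\mathrm{End}}^{\mathrm{opt}}, n) = O(n^{2/3})$.
   Context: Strings are finite sequences over an alphabet; $T[i..j]$ is the substring from position $i$ to $j$. An LZ-End factorization of $T$ is a factorization $T = f_1\cdots f_z$ into nonempty phrases where each phrase $f_k$ is either a single character not occurring in $f_1\cdots f_{k-1}$, or has an occurrence $T[i..j] = f_k$ with $j \le |f_1\cdots f_{k-1}|$ and $j = |f_1\cdots f_h|$ for some $1\le h<k$. $z_{\mathrm{End}}^{\mathrm{opt}}(T)$ is the minimum number of phrases of an LZ-End factorization of $T$. For a measure $c$, $\mathrm{AS}_{\mathrm{edit}}(c,n) = \max\{c(T')-c(T)\}$ over all strings $T$ of length $n$ and all $T'$ obtained from $T$ by a single edit of the given type (substitution, insertion or deletion of one character). *)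

theory Defs
  imports "HOL-Library.Landau_Symbols"
begin

definition substring :: "'a list \<Rightarrow> nat \<Rightarrow> nat \<Rightarrow> 'a list" where
  \<comment> \<open>T[i..j] with 1-based positions and both ends included\<close>
  "substring T i j = take (j + 1 - i) (drop (i - 1) T)"

text \<open>
  Phrases are stored in a 0-based list, so \<open>fs ! k\<close> is the phrase preceded by exactly \<open>k\<close>
  phrases, whose concatenation is \<open>concat (take k fs)\<close>. The number \<open>h\<close> below counts phrases,
  so the source must end at the end of one of the \<open>k\<close> preceding phrases.
\<close>

definition lz_end_factorization :: "'a list \<Rightarrow> 'a list list \<Rightarrow> bool" where
  "lz_end_factorization T fs \<longleftrightarrow>
     concat fs = T \<and>
     (\<forall>k < length fs.
        fs ! k \<noteq> [] \<and>
        ((\<exists>a. fs ! k = [a] \<and> a \<notin> set (concat (take k fs))) \<or>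
         (\<exists>i j. 1 \<le> i \<and> i \<le> j \<and> j \<le> length (concat (take k fs)) \<and>
            substring T i j = fs ! k \<and>
            (\<exists>h. 1 \<le> h \<and> h \<le> k \<and> j = length (concat (take h fs))))))"

definition z_end_opt :: "'a list \<Rightarrow> nat" where
  "z_end_opt T = (LEAST z. \<exists>fs. lz_end_factorization T fs \<and> length fs = z)"

datatype edit = Substitution | Insertion | Deletion

inductive single_edit :: "edit \<Rightarrow> 'a list \<Rightarrow> 'a list \<Rightarrow> bool" where
  substitution: "a \<noteq> b \<Longrightarrow> single_edit Substitution (xs @ a # ys) (xs @ b # ys)"
| insertion: "single_edit Insertion (xs @ ys) (xs @ a # ys)"
| deletion: "single_edit Deletion (xs @ a # ys) (xs @ ys)"

definition sensitivity_values :: "edit \<Rightarrow> ('a list \<Rightarrow> nat) \<Rightarrow> nat \<Rightarrow> int set" where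
  "sensitivity_values e c n =
     {int (c T') - int (c T) | T T'. length T = n \<and> single_edit e T T'}"

text \<open>
  The set of values is empty if no edit is possible, that is, for substitutions and deletions
  in the empty string and for substitutions over a one-letter alphabet. The maximum is then
  taken to be 0.
\<close>

definition additive_sensitivity :: "edit \<Rightarrow> ('a list \<Rightarrow> nat) \<Rightarrow> nat \<Rightarrow> int" where
  "additive_sensitivity e c n =
     (if sensitivity_values e c n = {} then 0 else Max (sensitivity_values e c n))"

text \<open>The minimum and the maximum above are attained.\<close>

lemma lz_end_factorization_singletons: "lz_end_factorization T (map (\<lambda>a. [a]) T)"
proof -
  have c: "concat (map (\<lambda>a. [a]) xs) = xs" for xs :: "'a list"
    by (induction xs) auto
  have ct: "concat (take m (map (\<lambda>a. [a]) T)) = take m T" for m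
    by (simp add: take_map c)
  have "(T ! k \<notin> set (take k T)) \<or>
         (\<exists>i j. 1 \<le> i \<and> i \<le> j \<and> j \<le> length (take k T) \<and>
            substring T i j = [T ! k] \<and>
            (\<exists>h. 1 \<le> h \<and> h \<le> k \<and> j = length (take h T)))" if k: "k < length T" for k
  proof (cases "T ! k \<in> set (take k T)")
    case True
    then obtain p where p: "p < k" "T ! p = T ! k"
      using k by (auto simp: in_set_conv_nth)
    have "substring T (Suc p) (Suc p) = [T ! k]"
      using p k by (simp add: substring_def take_Suc_conv_app_nth Cons_nth_drop_Suc[symmetric])
    moreover have "Suc p \<le> length (take k T)" "Suc p = length (take (Suc p) T)"
      using p k by auto
    ultimately show ?thesis
      using p by (metis One_nat_def Suc_leI le_refl le_add1 plus_1_eq_Suc)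
  qed auto
  then show ?thesis
    unfolding lz_end_factorization_def ct by (auto simp: c)
qed

lemma z_end_opt_attained: "\<exists>fs. lz_end_factorization T fs \<and> length fs = z_end_opt T"
  unfolding z_end_opt_def
  by (rule LeastI_ex) (use lz_end_factorization_singletons in blast)

lemma z_end_opt_le_length: "z_end_opt T \<le> length T"
  unfolding z_end_opt_def
  by (rule Least_le) (use lz_end_factorization_singletons[of T] in force)

lemma finite_sensitivity_values: "finite (sensitivity_values e (z_end_opt :: 'a list \<Rightarrow> nat) n)"
proof (rule finite_subset)
  show "sensitivity_values e (z_end_opt :: 'a list \<Rightarrow> nat) n \<subseteq> {- int n..int n + 1}"
  proof
    fix d assume "d \<in> sensitivity_values e (z_end_opt :: 'a list \<Rightarrow> nat) n"
    then obtain T T' :: "'a list" where d: "d = int (z_end_opt T') - int (z_end_opt T)"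
      and n: "length T = n" and e: "single_edit e T T'"
      by (auto simp: sensitivity_values_def)
    have "length T' \<le> n + 1"
      using e n by cases auto
    then show "d \<in> {- int n..int n + 1}"
      using d n z_end_opt_le_length[of T] z_end_opt_le_length[of T'] by auto
  qed
qed simp

end

theory Submission
  imports Defs "HOL-Library.Sublist"
begin

text \<open>
  An edit turns \<open>P @ c @ S\<close> into \<open>P @ c' @ S\<close>, where \<open>c\<close> and \<open>c'\<close> have length at most one. Refine the
  optimal factorization of the first string, keeping all phrase ends and adding one directly before
  and one directly after the edit. The part of the edited phrase before the edit costs
  \<open>O(sqrt n)\<close> phrases. A later phrase remains a valid phrase unless its source crosses the edit, in
  which case it falls into at most three phrases, and it only has to be split when it occurs as a
  phrase for the first time. A crossing phrase is determined by the numbers of characters it has on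
  both sides of the edit, so at most \<open>L^2\<close> distinct ones have length at most \<open>L\<close>, while at most
  \<open>n / L\<close> are longer. Take \<open>L\<close> close to \<open>n powr (1/3)\<close>. As the inverse of an edit is an edit, this
  bounds the sensitivity from below as well.
\<close>

section \<open>Factorizations as phrase lists with copying from phrase ends\<close>

text \<open>A list prefix \<open>H\<close> stands for a phrase end at which the source stops. It may
  be empty, so the empty word always counts as copyable.\<close>

definition copyable :: "'a list list \<Rightarrow> 'a list \<Rightarrow> bool" where
  "copyable G g \<longleftrightarrow> (\<exists>H. prefix H G \<and> suffix g (concat H))"

definition lz_phrase :: "'a list list \<Rightarrow> 'a list \<Rightarrow> bool" where
  "lz_phrase G g \<longleftrightarrow> g \<noteq> [] \<and> (copyable G g \<or> (\<exists>a. g = [a] \<and> a \<notin> set (concat G)))"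

definition lz_valid :: "'a list list \<Rightarrow> bool" where
  "lz_valid fs \<longleftrightarrow> (\<forall>k < length fs. lz_phrase (take k fs) (fs ! k))"

text \<open>A source ending at \<open>j\<close> lies within the prefix of length \<open>j\<close>,
  so its start merely tells how many characters of \<open>Q\<close> to drop.\<close>

lemma substring_eq_iff_suffix:
  assumes "j = length Q" "prefix Q T" "g \<noteq> []"
  shows "(\<exists>i. 1 \<le> i \<and> i \<le> j \<and> substring T i j = g) \<longleftrightarrow> suffix g Q"
proof -
  obtain R where T: "T = Q @ R" using assms(2) by (auto simp: prefix_def)
  have sub: "substring T i j = drop (i - 1) Q" if "1 \<le> i" "i \<le> j" for i
    using that assms(1) by (simp add: substring_def T)
  show ?thesis
  proof
    assume "\<exists>i. 1 \<le> i \<and> i \<le> j \<and> substring T i j = g"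
    then show "suffix g Q" using sub suffix_drop by metis
  next
    assume "suffix g Q"
    then obtain p where p: "Q = p @ g" by (auto simp: suffix_def)
    have "1 \<le> Suc (length p)" "Suc (length p) \<le> j"
      using p assms by (auto simp: Suc_le_eq)
    moreover have "drop (Suc (length p) - 1) Q = g" by (simp add: p)
    ultimately show "\<exists>i. 1 \<le> i \<and> i \<le> j \<and> substring T i j = g" using sub by metis
  qed
qed

lemma copyable_take_iff:
  assumes "k \<le> length fs" "g \<noteq> []"
  shows "copyable (take k fs) g \<longleftrightarrow>
    (\<exists>h. 1 \<le> h \<and> h \<le> k \<and> suffix g (concat (take h fs)))"
proof
  assume "copyable (take k fs) g"
  then obtain H where H: "prefix H (take k fs)" "suffix g (concat H)"
    by (auto simp: copyable_def)
  have "H = take (length H) fs"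
    using H(1) by (metis append_eq_conv_conj append_take_drop_id prefix_def prefix_order.trans take_is_prefix)
  moreover have "length H \<le> k"
    using H(1) assms(1) by (metis length_take min.absorb2 prefix_length_le)
  moreover have "H \<noteq> []" using H(2) assms(2) by (auto simp: suffix_def)
  ultimately show "\<exists>h. 1 \<le> h \<and> h \<le> k \<and> suffix g (concat (take h fs))"
    using H(2) by (metis One_nat_def Suc_leI length_greater_0_conv)
next
  assume "\<exists>h. 1 \<le> h \<and> h \<le> k \<and> suffix g (concat (take h fs))"
  then obtain h where "h \<le> k" "suffix g (concat (take h fs))" by blast
  moreover have "prefix (take h fs) (take k fs)"
    using \<open>h \<le> k\<close> by (metis min.absorb1 take_is_prefix take_take)
  ultimately show "copyable (take k fs) g" unfolding copyable_def by blast
qed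

lemma prefix_concat_mono: "prefix H G \<Longrightarrow> prefix (concat H) (concat G)"
  by (auto simp: prefix_def)

text \<open>Replaces positions by list prefixes, so that factorizations can be built by appending
  phrases.\<close>

lemma lz_end_factorization_iff:
  "lz_end_factorization T fs \<longleftrightarrow> concat fs = T \<and> lz_valid fs"
proof (cases "concat fs = T")
  case True
  have copy: "(\<exists>i j. 1 \<le> i \<and> i \<le> j \<and> j \<le> length (concat (take k fs)) \<and> substring T i j = fs ! k \<and>
            (\<exists>h. 1 \<le> h \<and> h \<le> k \<and> j = length (concat (take h fs)))) \<longleftrightarrow>
        copyable (take k fs) (fs ! k)" (is "?l \<longleftrightarrow> ?r") if k: "k < length fs" "fs ! k \<noteq> []" for k
  proof -
    have pre: "prefix (concat (take h fs)) T" for h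
      using True prefix_concat_mono take_is_prefix by metis
    have le: "length (concat (take h fs)) \<le> length (concat (take k fs))" if "h \<le> k" for h
      using that prefix_concat_mono[of "take h fs" "take k fs"] prefix_length_le
      by (metis min.absorb1 take_is_prefix take_take)
    have eq: "(\<exists>i. 1 \<le> i \<and> i \<le> length (concat (take h fs)) \<and>
        substring T i (length (concat (take h fs))) = fs ! k) \<longleftrightarrow> suffix (fs ! k) (concat (take h fs))" for h
      by (rule substring_eq_iff_suffix[OF refl pre k(2)])
    have "?l \<longleftrightarrow> (\<exists>h. 1 \<le> h \<and> h \<le> k \<and> (\<exists>i. 1 \<le> i \<and> i \<le> length (concat (take h fs)) \<and>
        substring T i (length (concat (take h fs))) = fs ! k))"
      using le by metis
    also have "\<dots> \<longleftrightarrow> ?r" unfolding eq using copyable_take_iff k by (metis less_imp_le)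
    finally show ?thesis .
  qed
  show ?thesis
    unfolding lz_end_factorization_def lz_valid_def lz_phrase_def
    using copy True by (intro conj_cong refl all_cong) blast
qed (auto simp: lz_end_factorization_def)

lemma lz_valid_Nil [simp]: "lz_valid []"
  by (simp add: lz_valid_def)

lemma lz_valid_snoc: "lz_valid (fs @ [g]) \<longleftrightarrow> lz_valid fs \<and> lz_phrase fs g"
  by (auto simp: lz_valid_def less_Suc_eq nth_append)

lemma lz_valid_appendD: "lz_valid (fs @ gs) \<Longrightarrow> lz_valid fs"
proof (induction gs rule: rev_induct)
  case (snoc g gs)
  then show ?case using lz_valid_snoc[of "fs @ gs" g] by simp
qed simp

lemma copyable_mono: "copyable G g \<Longrightarrow> prefix G H \<Longrightarrow> copyable H g"
  unfolding copyable_def using prefix_order.trans by blast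

lemma copyable_suffix: "copyable G g \<Longrightarrow> suffix h g \<Longrightarrow> copyable G h"
  unfolding copyable_def using suffix_order.trans by blast

lemma copyable_self: "suffix g (concat G) \<Longrightarrow> copyable G g"
  unfolding copyable_def by blast

lemma copyable_sublist: "copyable G g \<Longrightarrow> sublist g (concat G)"
  unfolding copyable_def
  using prefix_imp_sublist[OF prefix_concat_mono] suffix_imp_sublist
  by (blast intro: sublist_order.order_trans)

text \<open>The first phrase containing \<open>a\<close> cannot be copied, so it is
  \<open>[a]\<close> itself, and its end is a suitable source end.\<close>

lemma copyable_singleton: "lz_valid G \<Longrightarrow> a \<in> set (concat G) \<Longrightarrow> copyable G [a]"
proof (induction G rule: rev_induct)
  case (snoc g G)
  have mono: "copyable (G @ [g]) [a]" if "copyable G [a]"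
    using that copyable_mono by (metis prefixI)
  show ?case
  proof (cases "a \<in> set (concat G)")
    case True
    then show ?thesis using snoc.IH snoc.prems(1) mono by (simp only: lz_valid_snoc)
  next
    case False
    then have "a \<in> set g" using snoc by auto
    moreover have "\<not> copyable G g"
      using copyable_sublist False \<open>a \<in> set g\<close> by (metis set_mono_sublist subsetD)
    ultimately have "g = [a]"
      using snoc.prems(1) by (auto simp: lz_valid_snoc lz_phrase_def)
    then show ?thesis by (auto intro!: copyable_self simp: suffix_def)
  qed
qed simp

lemma lz_phrase_singleton: "lz_valid G \<Longrightarrow> lz_phrase G [a]"
  using copyable_singleton[of G a] unfolding lz_phrase_def by (metis list.discI)

lemma lz_valid_append_copyable:
  assumes "lz_valid G" "\<And>g. g \<in> set gs \<Longrightarrow> g \<noteq> [] \<and> copyable G g"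
  shows "lz_valid (G @ gs)"
  using assms(2)
proof (induction gs rule: rev_induct)
  case (snoc g gs)
  then have "copyable (G @ gs) g" "g \<noteq> []"
    using copyable_mono[of G g "G @ gs"] by auto
  then show ?case using snoc
    by (simp add: lz_valid_snoc lz_phrase_def flip: append_assoc)
qed (use assms in simp)

text \<open>Treats the pieces of a split phrase uniformly: an empty piece costs no phrase, and a
  single character is always a legal phrase.\<close>

lemma lz_valid_append_small:
  assumes "lz_valid G" "length w \<le> 1 \<or> copyable G w"
  obtains gs where "lz_valid (G @ gs)" "concat gs = w" "length gs \<le> 1"
proof (cases "w = []")
  case True
  then show ?thesis using that[of "[]"] assms by simp
next
  case False
  have "lz_phrase G w"
  proof (cases "copyable G w")
    case True
    then show ?thesis using False by (simp add: lz_phrase_def)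
  next
    case nc: False
    then obtain a where "w = [a]" using assms(2) False by (cases w) auto
    then show ?thesis using lz_phrase_singleton assms(1) by simp
  qed
  then show ?thesis using that[of "[w]"] assms by (simp add: lz_valid_snoc)
qed

section \<open>Parsing a factor of the text into copied phrases\<close>

lemma length_le_length_concat: "[] \<notin> set gs \<Longrightarrow> length gs \<le> length (concat gs)"
proof (induction gs)
  case (Cons g gs)
  then show ?case by (cases g) auto
qed simp

text \<open>
  Let \<open>g\<close> be the phrase in which the leftmost occurrence of \<open>x\<close> ends. The part of \<open>x\<close> before \<open>g\<close> is
  copied as one phrase. The rest \<open>v\<close> is a prefix of \<open>g\<close> and, unless \<open>v = g\<close>, already occurs before
  \<open>g\<close>. Recursively it takes at most \<open>length v\<close> phrases, which is less than \<open>length g\<close>; so \<open>r\<close> phrases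
  in total require a string of length at least \<open>1 + 2 + \<dots> + (r - 1)\<close>.
\<close>

lemma sublist_parse:
  assumes "lz_valid G" "sublist x (concat G)" "x \<noteq> []"
  shows "\<exists>gs. concat gs = x \<and> (\<forall>g \<in> set gs. g \<noteq> [] \<and> copyable G g) \<and>
    length gs * (length gs - 1) \<le> 2 * length (concat G)"
  using assms
proof (induction G arbitrary: x rule: rev_induct)
  case (snoc g G)
  have one: ?case if "copyable (G @ [g]) x"
    using that snoc.prems by (intro exI[of _ "[x]"]) auto
  have G: "lz_valid G" and g: "lz_phrase G g" using snoc.prems by (auto simp: lz_valid_snoc)
  have mono: "copyable (G @ [g]) w" if "copyable G w" for w
    using that copyable_mono by (metis prefixI)
  have rec: ?case if x: "sublist x (concat G)"
  proof -
    obtain gs where "concat gs = x" "\<forall>g \<in> set gs. g \<noteq> [] \<and> copyable G g"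
      "length gs * (length gs - 1) \<le> 2 * length (concat G)"
      using snoc.IH[OF G x snoc.prems(3)] by blast
    then show ?thesis using mono by (intro exI[of _ gs]) auto
  qed
  have inside: ?case if x: "sublist x g"
  proof (cases "copyable G g")
    case True
    then show ?thesis using rec x copyable_sublist sublist_order.order_trans by blast
  next
    case False
    then obtain a where "g = [a]" using g by (auto simp: lz_phrase_def)
    moreover have "length x \<le> length g" using x sublist_length_le by blast
    ultimately have "x = g"
      using x snoc.prems(3) by (metis append_Nil append_Nil2 sublist_Cons_right sublist_Nil_right prefix_Cons prefix_Nil list.inject)
    then have "suffix x (concat (G @ [g]))" by (simp add: suffix_def)
    then show ?thesis using one copyable_self by blast
  qed
  have "sublist x (concat G @ g)" using snoc.prems by simp
  then consider "sublist x (concat G)" | "sublist x g"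
    | u v where "x = u @ v" "suffix u (concat G)" "prefix v g"
    unfolding sublist_append by blast
  then show ?case
  proof cases
    case 1
    then show ?thesis by (rule rec)
  next
    case 2
    then show ?thesis by (rule inside)
  next
    case 3
    show ?thesis
    proof (cases "v = g \<or> v = [] \<or> u = []")
      case True
      then consider "v = g" | "v = []" | "u = []" by blast
      then show ?thesis
      proof cases
        case a: 1
        obtain p where "concat G = p @ u" using 3 by (auto simp: suffix_def)
        then have "suffix x (concat (G @ [g]))" using a 3 by (auto simp: suffix_def)
        then show ?thesis using one copyable_self by blast
      next
        case 2
        then show ?thesis using 3 rec by (simp add: suffix_imp_sublist)
      next
        case b: 3
        then show ?thesis using 3 inside by (simp add: prefix_imp_sublist)
      qed
    next
      case False
      then have len: "length v < length g" using 3
        by (metis prefix_def append_eq_append_conv append_Nil2 le_neq_implies_less prefix_length_le)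
      then have "\<not> (\<exists>a. g = [a])" using False by (cases v) auto
      then have "copyable G g" using g by (auto simp: lz_phrase_def)
      then have "sublist v (concat G)"
        using 3 copyable_sublist prefix_imp_sublist sublist_order.order_trans by blast
      then obtain gs where gs: "concat gs = v" "\<forall>g \<in> set gs. g \<noteq> [] \<and> copyable G g"
        "length gs * (length gs - 1) \<le> 2 * length (concat G)"
        using snoc.IH[OF G] False by blast
      have "length gs \<le> length (concat gs)" using gs(2)
        by (intro length_le_length_concat) blast
      then have l: "length gs < length g" using gs(1) len by simp
      \<comment> \<open>Adding the phrase \<open>u\<close> raises the product by
        \<open>2 * length gs\<close>, which the length of \<open>g\<close> pays for.\<close>
      have "Suc (length gs) * length gs = length gs * (length gs - 1) + 2 * length gs"
        by (cases "length gs") auto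
      also have "\<dots> \<le> 2 * length (concat (G @ [g]))" using gs(3) l by simp
      finally show ?thesis
        using 3 gs False mono copyable_self[of u G] by (intro exI[of _ "u # gs"]) auto
    qed
  qed
qed simp

section \<open>Simulating the original factorization behind the edit\<close>

text \<open>\<open>Q\<close> will be the original text up to and including the edited character and
  \<open>S\<close> the rest, so these are the words whose source the edit may destroy.\<close>

definition crossing :: "'a list \<Rightarrow> 'a list \<Rightarrow> 'a list \<Rightarrow> bool" where
  "crossing Q S b \<longleftrightarrow> (\<exists>u w. u \<noteq> [] \<and> suffix u Q \<and> prefix w S \<and> b = u @ w)"

lemma suffix_append_cases:
  assumes "suffix b (Q @ W)"
  shows "suffix b W \<or> (\<exists>u. u \<noteq> [] \<and> suffix u Q \<and> b = u @ W)"
proof -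
  consider "suffix b W" | u where "b = u @ W" "suffix u Q"
    using assms unfolding suffix_append by blast
  then show ?thesis by cases (fastforce, cases "b = W", auto)
qed

lemma suffix_snoc_small:
  assumes "suffix u (P @ c)" "length c \<le> 1"
  obtains p d where "u = p @ d" "suffix p P" "length d \<le> 1"
proof -
  consider "suffix u c" | p where "u = p @ c" "suffix p P"
    using assms(1) unfolding suffix_append by blast
  then show ?thesis
  proof cases
    case 1
    then have "length u \<le> 1" using assms(2) suffix_length_le order.trans by blast
    then show ?thesis using that[of "[]" u] by simp
  qed (use that assms(2) in blast)
qed

text \<open>A crossing word counts only on its first appearance, the one time the simulation may
  need three phrases for it.\<close>

lemma card_filter_snoc:
  "card {b \<in> set (bs @ [b']). C b} =
    card {b \<in> set bs. C b} + (if b' \<notin> set bs \<and> C b' then 1 else 0)"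
proof -
  have "{b \<in> set (bs @ [b']). C b} = (if C b' then insert b' {b \<in> set bs. C b} else {b \<in> set bs. C b})"
    by auto
  then show ?thesis by (auto simp: card_insert_if)
qed

text \<open>\<open>as\<close> and \<open>bs\<close> are the phrases before and after the edited
  phrase \<open>f\<close>, whose part behind the edit is \<open>y\<close>; \<open>G0\<close> already
  covers \<open>f\<close> in the new text. The induction carries along that each original phrase end
  from the end of \<open>f\<close> on survives as a phrase end of \<open>G\<close>, which keeps
  sources available.\<close>

lemma edit_simulation:
  assumes G0: "lz_valid G0" "prefix as G0" "prefix H0 G0" "concat H0 = P"
    "concat G0 = P @ c' @ y"
    and PQ: "P @ c @ y = concat (as @ [f])"
    and c: "length c \<le> 1"
  shows "lz_valid (as @ f # bs) \<Longrightarrow> prefix (y @ concat bs) S \<Longrightarrow>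
    \<exists>G. lz_valid G \<and> prefix G0 G \<and> concat G = P @ c' @ y @ concat bs \<and>
      (\<forall>B. prefix B bs \<longrightarrow> (\<exists>H. prefix H G \<and> concat H = P @ c' @ y @ concat B)) \<and>
      length G \<le> length G0 + length bs + 2 * card {b \<in> set bs. crossing (P @ c) S b}"
proof (induction bs rule: rev_induct)
  case Nil
  show ?case by (rule exI[of _ G0]) (use G0 in auto)
next
  case (snoc b bs)
  have valid: "lz_valid (as @ f # bs)" and b: "lz_phrase (as @ f # bs) b"
    using snoc.prems(1) lz_valid_snoc[of "as @ f # bs" b] by auto
  have S: "prefix (y @ concat bs) S"
    using snoc.prems(2) by (auto simp: prefix_def)
  obtain G where G: "lz_valid G" "prefix G0 G" "concat G = P @ c' @ y @ concat bs"
    and ends: "\<And>B. prefix B bs \<Longrightarrow> \<exists>H. prefix H G \<and> concat H = P @ c' @ y @ concat B"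
    and len: "length G \<le> length G0 + length bs + 2 * card {b \<in> set bs. crossing (P @ c) S b}"
    using snoc.IH[OF valid S] by blast
  have bne: "b \<noteq> []" using b by (simp add: lz_phrase_def)
  \<comment> \<open>One phrase plus two extra ones, matching the factor \<open>2\<close> before the
    cardinality.\<close>
  let ?k = "if b \<notin> set bs \<and> crossing (P @ c) S b then 3 else 1 :: nat"
  have suf: "copyable G g" if BP: "prefix B bs" "suffix g (P @ c' @ y @ concat B)" for g B
  proof -
    obtain H where "prefix H G" "concat H = P @ c' @ y @ concat B" using ends[OF BP(1)] by blast
    then show ?thesis using BP(2) by (auto simp: copyable_def)
  qed
  have "\<exists>gs. lz_valid (G @ gs) \<and> concat gs = b \<and> length gs \<le> ?k"
  proof -
    have one: ?thesis if b1: "length b \<le> 1 \<or> copyable G b"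
    proof -
      obtain gs where "lz_valid (G @ gs)" "concat gs = b" "length gs \<le> 1"
        by (rule lz_valid_append_small[OF G(1) b1])
      then show ?thesis by (intro exI[of _ gs]) simp
    qed
    consider a where "b = [a]" | "copyable (as @ f # bs) b"
      using b by (auto simp: lz_phrase_def)
    then show ?thesis
    proof cases
      case 1
      then show ?thesis using one by simp
    next
      case 2
      then obtain H where H: "prefix H (as @ f # bs)" "suffix b (concat H)"
        unfolding copyable_def by blast
      \<comment> \<open>The source ends at the start of \<open>f\<close> at the latest or at the end
        of \<open>f\<close> at the earliest, since no phrase end lies inside
        \<open>f\<close>.\<close>
      consider "prefix H as" | B where "H = (as @ [f]) @ B" "prefix B bs"
      proof (cases "prefix H as")
        case False
        then obtain us where us: "H = as @ us" "prefix us (f # bs)"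
          using H(1) unfolding prefix_append by blast
        with False obtain B where "us = f # B" "prefix B bs" by (cases us) auto
        then show ?thesis using that us by simp
      qed
      then show ?thesis
      proof cases
        case 1
        then have "prefix H G" using G0(2) G(2) prefix_order.trans by blast
        then show ?thesis using one H(2) unfolding copyable_def by blast
      next
        case 2
        let ?W = "y @ concat B"
        have H': "concat H = (P @ c) @ ?W" using 2 PQ by simp
        have W: "suffix w ?W \<Longrightarrow> copyable G w" for w
          using suf[OF 2(2), of w] by (metis append_assoc suffix_appendI)
        from suffix_append_cases[OF H(2)[unfolded H']]
        consider "suffix b ?W" | u where "u \<noteq> []" "suffix u (P @ c)" "b = u @ ?W" by blast
        then show ?thesis
        proof cases
          case 1
          then show ?thesis using one W by blast
        next
          case u: 2
          show ?thesis
          proof (cases "b \<in> set bs")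
            case True
            \<comment> \<open>The earlier copy of \<open>b\<close> is itself a phrase whose end was
              kept, so it serves as the new source.\<close>
            then obtain B1 B2 where B: "bs = B1 @ b # B2" by (meson split_list)
            have "copyable G b"
              by (rule suf[of "B1 @ [b]"]) (auto simp: B suffix_def)
            then show ?thesis using one by blast
          next
            case False
            have "prefix ?W (y @ concat bs)" using 2(2) prefix_concat_mono by simp
            then have "prefix ?W S" using S prefix_order.trans by blast
            then have cr: "crossing (P @ c) S b" using u by (auto simp: crossing_def)
            \<comment> \<open>The word is cut around the edited character: \<open>p\<close> is a
              suffix of \<open>P\<close>, \<open>d\<close> is at most one character, and
              \<open>?W\<close> ends at a kept phrase end.\<close>
            obtain p d where pd: "u = p @ d" "suffix p P" "length d \<le> 1"
              using suffix_snoc_small[OF u(2) c] by blast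
            have "copyable G p"
              using pd(2) G0(3,4) G(2) unfolding copyable_def by (metis prefix_order.trans)
            then obtain g1 where g1: "lz_valid (G @ g1)" "concat g1 = p" "length g1 \<le> 1"
              using lz_valid_append_small[OF G(1)] by metis
            obtain g2 where g2: "lz_valid ((G @ g1) @ g2)" "concat g2 = d" "length g2 \<le> 1"
              using lz_valid_append_small[OF g1(1)] pd(3) by metis
            have "copyable ((G @ g1) @ g2) ?W"
              using W[OF suffix_order.refl] copyable_mono by (metis append_assoc prefixI)
            then obtain g3 where g3: "lz_valid (((G @ g1) @ g2) @ g3)" "concat g3 = ?W" "length g3 \<le> 1"
              using lz_valid_append_small[OF g2(1)] by metis
            show ?thesis using g1 g2 g3 pd u False cr
              by (intro exI[of _ "g1 @ g2 @ g3"]) auto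
          qed
        qed
      qed
    qed
  qed
  then obtain gs where gs: "lz_valid (G @ gs)" "concat gs = b" "length gs \<le> ?k" by blast
  have "\<exists>H. prefix H (G @ gs) \<and> concat H = P @ c' @ y @ concat B" if "prefix B (bs @ [b])" for B
  proof (cases "prefix B bs")
    case True
    then show ?thesis using ends by (meson prefix_prefix)
  next
    case False
    then have "B = bs @ [b]" using that by simp
    then show ?thesis using G gs by (intro exI[of _ "G @ gs"]) auto
  qed
  moreover have "length (G @ gs) \<le> length G0 + length (bs @ [b]) +
      2 * card {a \<in> set (bs @ [b]). crossing (P @ c) S a}"
    unfolding card_filter_snoc using len gs(3) by (auto split: if_splits)
  ultimately show ?case using G gs
    by (intro exI[of _ "G @ gs"]) (auto simp: prefix_prefix)
qed

section \<open>Counting crossing words\<close>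

lemma card_crossing_short:
  "finite {b. crossing Q S b \<and> length b \<le> L}"
  "card {b. crossing Q S b \<and> length b \<le> L} \<le> L ^ 2"
proof -
  \<comment> \<open>A pair holds the lengths of \<open>u\<close> and \<open>w\<close>; as
    \<open>u\<close> is nonempty, the second is less than \<open>L\<close>, which yields exactly
    \<open>L * L\<close> pairs.\<close>
  let ?I = "{1..L} \<times> {..<L}"
  let ?h = "\<lambda>(i, j). drop (length Q - i) Q @ take j S"
  have sub: "{b. crossing Q S b \<and> length b \<le> L} \<subseteq> ?h ` ?I"
  proof
    fix b assume "b \<in> {b. crossing Q S b \<and> length b \<le> L}"
    then obtain u w where b: "u \<noteq> []" "suffix u Q" "prefix w S" "b = u @ w" "length b \<le> L"
      by (auto simp: crossing_def)
    have "b = ?h (length u, length w)"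
      using b by (auto simp: suffix_def prefix_def)
    moreover have "1 \<le> length u" "length u \<le> L" "length w < L"
      using b(4,5) length_greater_0_conv[of u] b(1) by (simp_all add: Suc_le_eq del: length_greater_0_conv)
    ultimately show "b \<in> ?h ` ?I" by (intro image_eqI[of _ _ "(length u, length w)"]) auto
  qed
  show "finite {b. crossing Q S b \<and> length b \<le> L}"
    by (rule finite_subset[OF sub]) auto
  have "card {b. crossing Q S b \<and> length b \<le> L} \<le> card ?I"
    using card_mono[OF _ sub] card_image_le[of ?I ?h] by (meson finite_SigmaI finite_atLeastAtMost finite_imageI finite_lessThan order.trans)
  then show "card {b. crossing Q S b \<and> length b \<le> L} \<le> L ^ 2"
    by (simp add: power2_eq_square)
qed

lemma sum_length_set_le: "(\<Sum>b\<in>set bs. length b) \<le> length (concat bs)"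
proof (induction bs)
  case (Cons b bs)
  then show ?case by (cases "b \<in> set bs") (auto simp: insert_absorb)
qed simp

text \<open>At most \<open>L ^ 2\<close> crossing words have length up to \<open>L\<close>; the
  distinct longer phrases have total length at most that of \<open>concat bs\<close>. Multiplying by
  \<open>L\<close> avoids division and leaves \<open>L\<close> free.\<close>

lemma card_crossing:
  "L * card {b \<in> set bs. crossing Q S b} \<le> L ^ 3 + length (concat bs)"
proof -
  let ?A = "{b. crossing Q S b \<and> length b \<le> L}" and ?B = "{b \<in> set bs. L < length b}"
  have "card {b \<in> set bs. crossing Q S b} \<le> card (?A \<union> ?B)"
    by (rule card_mono) (use card_crossing_short in auto)
  also have "\<dots> \<le> L ^ 2 + card ?B"
    using card_Un_le[of ?A ?B] card_crossing_short(2)[of Q S L] by linarith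
  finally have "L * card {b \<in> set bs. crossing Q S b} \<le> L * (L ^ 2 + card ?B)" by simp
  also have "\<dots> = L ^ 3 + L * card ?B" by (simp add: algebra_simps power2_eq_square power3_eq_cube)
  also have "L * card ?B = (\<Sum>b\<in>?B. L)" by simp
  also have "(\<Sum>b\<in>?B. L) \<le> (\<Sum>b\<in>?B. length b)" by (rule sum_mono) auto
  also have "\<dots> \<le> (\<Sum>b\<in>set bs. length b)" by (rule sum_mono2) auto
  also have "\<dots> \<le> length (concat bs)" by (rule sum_length_set_le)
  finally show ?thesis by simp
qed

section \<open>Rebuilding the factorization around the edit\<close>

text \<open>A piece of length at most one cannot straddle a phrase end, so the first phrase reaching
  its end contains all of it. For an insertion at a phrase end this is the phrase to the left, with
  \<open>y\<close> empty.\<close>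

lemma concat_split_at_edit:
  assumes "concat fs = P @ c @ S" "length c \<le> 1" "fs \<noteq> []"
  shows "\<exists>as f bs x y. fs = as @ f # bs \<and> P = concat as @ x \<and> f = x @ c @ y \<and> S = y @ concat bs"
  using assms
proof (induction fs arbitrary: P)
  case (Cons f fs)
  show ?case
  proof (cases "length (P @ c) \<le> length f")
    case True
    then have "prefix (P @ c) f"
      using Cons.prems(1) by (metis append_assoc concat.simps(2) prefixI prefix_length_prefix)
    then obtain y where y: "f = P @ c @ y" by (auto simp: prefix_def)
    then show ?thesis using Cons.prems
      by (intro exI[of _ "[]"] exI[of _ f] exI[of _ fs] exI[of _ P] exI[of _ y]) simp
  next
    case False
    then have "length f \<le> length P" using Cons.prems(2) by auto
    then have "prefix f P"
      using Cons.prems(1) by (metis concat.simps(2) prefixI prefix_length_prefix)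
    then obtain P' where P': "P = f @ P'" by (auto simp: prefix_def)
    have e: "concat fs = P' @ c @ S" using Cons.prems(1) P' by simp
    have "fs \<noteq> []" using e False P' by auto
    from Cons.IH[OF e Cons.prems(2) this] obtain as g bs x y where
      "fs = as @ g # bs \<and> P' = concat as @ x \<and> g = x @ c @ y \<and> S = y @ concat bs" by blast
    then show ?thesis using P' by (intro exI[of _ "f # as"] exI[of _ g] exI[of _ bs] exI[of _ x] exI[of _ y]) simp
  qed
qed simp

text \<open>\<open>r\<close> counts the phrases for the part of the edited phrase before the edit,
  and \<open>N\<close> the distinct crossing phrases. Since \<open>N\<close> does not depend on
  \<open>L\<close>, a good \<open>L\<close> can be picked afterwards.\<close>

lemma lz_valid_edit:
  assumes valid: "lz_valid fs" and T: "concat fs = P @ c @ S" "fs \<noteq> []"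
    and c: "length c \<le> 1" "length c' \<le> 1"
  shows "\<exists>G r N. lz_valid G \<and> concat G = P @ c' @ S \<and> length G \<le> length fs + r + 1 + 2 * N \<and>
    r * (r - 1) \<le> 2 * length (concat fs) \<and> (\<forall>L. L * N \<le> L ^ 3 + length (concat fs))"
proof -
  obtain as f bs x y where fs: "fs = as @ f # bs" and P: "P = concat as @ x"
    and f: "f = x @ c @ y" and S: "S = y @ concat bs"
    using concat_split_at_edit[OF T(1) c(1) T(2)] by blast
  have "lz_valid (as @ [f])" using valid lz_valid_appendD[of "as @ [f]" bs] fs by simp
  then have as: "lz_valid as" and ph: "lz_phrase as f" by (auto simp: lz_valid_snoc)
  have cases_f: "copyable as f \<or> length f \<le> 1" using ph by (auto simp: lz_phrase_def)
  have "\<exists>g1. lz_valid (as @ g1) \<and> concat g1 = x \<and>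
    length g1 * (length g1 - 1) \<le> 2 * length (concat fs)"
  \<comment> \<open>As \<open>x\<close> is a prefix of \<open>f\<close>, its copy inside
    \<open>concat as\<close> need not end at a phrase end, so it has to be parsed.\<close>
  proof (cases "copyable as f \<and> x \<noteq> []")
    case True
    then have "sublist x (concat as)"
      using f copyable_sublist by (metis prefixI prefix_imp_sublist sublist_order.order_trans)
    then obtain gs where "concat gs = x" "\<forall>g \<in> set gs. g \<noteq> [] \<and> copyable as g"
      "length gs * (length gs - 1) \<le> 2 * length (concat as)"
      using sublist_parse[OF as] True by blast
    then show ?thesis using lz_valid_append_copyable[OF as, of gs] fs by (intro exI[of _ gs]) auto
  next
    case False
    then have "length x \<le> 1" using cases_f f by auto
    then obtain gs where "lz_valid (as @ gs)" "concat gs = x" "length gs \<le> 1"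
      using lz_valid_append_small[OF as] by metis
    then show ?thesis by (intro exI[of _ gs]) (auto simp: le_Suc_eq)
  qed
  then obtain g1 where g1: "lz_valid (as @ g1)" "concat g1 = x"
    "length g1 * (length g1 - 1) \<le> 2 * length (concat fs)" by blast
  obtain g2 where g2: "lz_valid ((as @ g1) @ g2)" "concat g2 = c'" "length g2 \<le> 1"
    using lz_valid_append_small[OF g1(1)] c(2) by metis
  have "length y \<le> 1 \<or> copyable ((as @ g1) @ g2) y"
  proof (cases "copyable as f")
    case True
    \<comment> \<open>As a suffix of \<open>f\<close>, \<open>y\<close> has the same source end as
      \<open>f\<close> and costs at most a single phrase.\<close>
    then have "copyable as y" using f copyable_suffix by (metis append_assoc suffixI)
    then show ?thesis using copyable_mono by (metis append_assoc prefixI)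
  qed (use cases_f f in auto)
  then obtain g3 where g3: "lz_valid (((as @ g1) @ g2) @ g3)" "concat g3 = y" "length g3 \<le> 1"
    using lz_valid_append_small[OF g2(1)] by metis
  define G0 where "G0 = ((as @ g1) @ g2) @ g3"
  define N where "N = card {b \<in> set bs. crossing (P @ c) S b}"
  have "\<exists>G. lz_valid G \<and> prefix G0 G \<and> concat G = P @ c' @ y @ concat bs \<and>
      (\<forall>B. prefix B bs \<longrightarrow> (\<exists>H. prefix H G \<and> concat H = P @ c' @ y @ concat B)) \<and>
      length G \<le> length G0 + length bs + 2 * N"
    unfolding N_def
  proof (rule edit_simulation)
    show "lz_valid G0" "prefix as G0" "prefix (as @ g1) G0" using g3 by (auto simp: G0_def)
    show "concat (as @ g1) = P" "concat G0 = P @ c' @ y" "P @ c @ y = concat (as @ [f])"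
      using g1 g2 g3 P f by (auto simp: G0_def)
    show "lz_valid (as @ f # bs)" "prefix (y @ concat bs) S" using valid fs S by auto
  qed (rule c)
  then obtain G where G: "lz_valid G" "concat G = P @ c' @ S"
    "length G \<le> length G0 + length bs + 2 * N"
    using S by auto
  \<comment> \<open>\<open>c'\<close> and \<open>y\<close> cost at most two phrases, while
    \<open>f\<close> disappears: hence the \<open>+ 1\<close> below.\<close>
  have "length G0 \<le> length as + length g1 + 2" using g2 g3 by (simp add: G0_def)
  then have "length G \<le> length fs + length g1 + 1 + 2 * N" using G(3) fs by simp
  moreover have "L * N \<le> L ^ 3 + length (concat fs)" for L
    using card_crossing[of L bs "P @ c" S] fs by (simp add: N_def)
  ultimately show ?thesis using G g1 by blast
qed

lemma z_end_opt_edit_nat: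
  assumes c: "length c \<le> 1" "length c' \<le> 1" and ne: "P @ c @ S \<noteq> []"
  shows "\<exists>r N. z_end_opt (P @ c' @ S) \<le> z_end_opt (P @ c @ S) + r + 1 + 2 * N \<and>
    r * (r - 1) \<le> 2 * length (P @ c @ S) \<and> (\<forall>L. L * N \<le> L ^ 3 + length (P @ c @ S))"
proof -
  obtain fs where fs: "concat fs = P @ c @ S" "lz_valid fs" "length fs = z_end_opt (P @ c @ S)"
    using z_end_opt_attained lz_end_factorization_iff by metis
  have "fs \<noteq> []" using fs(1) ne by auto
  from lz_valid_edit[OF fs(2,1) this c] obtain G r N where G: "lz_valid G" "concat G = P @ c' @ S"
    "length G \<le> length fs + r + 1 + 2 * N" "r * (r - 1) \<le> 2 * length (P @ c @ S)"
    "\<forall>L. L * N \<le> L ^ 3 + length (P @ c @ S)"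
    unfolding fs(1) by blast
  have "z_end_opt (P @ c' @ S) \<le> length G"
    unfolding z_end_opt_def by (rule Least_le) (use G lz_end_factorization_iff in blast)
  then show ?thesis using G fs(3) by (intro exI[of _ r] exI[of _ N]) auto
qed

section \<open>Numerical estimate and both directions of the edit\<close>

text \<open>For \<open>a\<close> the cube root of the length, \<open>r \<le> 2 * a ^ 2 + 1\<close>
  and \<open>N \<le> 5 * a ^ 2\<close>, so
  \<open>r + 1 + 2 * N \<le> 12 * a ^ 2 + 2 \<le> 14 * a ^ 2\<close>.\<close>

lemma z_end_opt_edit:
  assumes "length c \<le> 1" "length c' \<le> 1" and ne: "P @ c @ S \<noteq> []"
  shows "real (z_end_opt (P @ c' @ S)) \<le>
    real (z_end_opt (P @ c @ S)) + 14 * real (length (P @ c @ S)) powr (2/3)"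
proof -
  define n where "n = length (P @ c @ S)"
  obtain r N where le: "z_end_opt (P @ c' @ S) \<le> z_end_opt (P @ c @ S) + r + 1 + 2 * N"
    and r: "r * (r - 1) \<le> 2 * n" and N: "\<And>L. L * N \<le> L ^ 3 + n"
    using z_end_opt_edit_nat[OF assms] unfolding n_def by blast
  have n1: "real n \<ge> 1" using ne unfolding n_def by (cases "P @ c @ S") auto
  define a where "a = real n powr (1/3)"
  have a1: "a \<ge> 1" unfolding a_def using n1 by (rule ge_one_powr_ge_zero) simp
  have a2: "real n powr (2/3) = a ^ 2" and a3: "real n = a ^ 3"
    using n1 by (simp_all add: a_def powr_powr flip: powr_realpow)
  have a12: "a \<le> a ^ 2" using a1 by (simp add: power2_eq_square)
  \<comment> \<open>Rounding up gives \<open>a \<le> L \<le> 2 * a\<close>: the first bound lets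
    \<open>L\<close> cancel from the inequality for \<open>N\<close>, the second gives
    \<open>N \<le> 4 * a ^ 2 + a ^ 2\<close>.\<close>
  define L where "L = nat \<lceil>a\<rceil>"
  have L: "a \<le> real L" "real L \<le> a + 1" using a1 unfolding L_def by linarith+
  have "real L * real N \<le> real L ^ 3 + a ^ 3"
    using N[of L] a3 by (metis of_nat_add of_nat_le_iff of_nat_mult of_nat_power)
  also have "\<dots> \<le> real L * real L ^ 2 + real L * a ^ 2"
    using L a1 by (simp add: power3_eq_cube power2_eq_square mult_right_mono)
  also have "\<dots> = real L * (real L ^ 2 + a ^ 2)" by (simp add: algebra_simps)
  finally have "real N \<le> real L ^ 2 + a ^ 2" using L a1 by simp
  also have "real L ^ 2 \<le> (2 * a) ^ 2" using L a1 by (intro power_mono) auto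
  finally have N': "real N \<le> 5 * a ^ 2" by (simp add: power2_eq_square)
  \<comment> \<open>The bound on \<open>r * (r - 1)\<close> has order \<open>a ^ 3\<close>; it is
    relaxed to the perfect square \<open>4 * a ^ 4\<close>, since order \<open>a ^ 2\<close> for
    \<open>r\<close> is enough.\<close>
  have "real r - 1 \<le> 2 * a ^ 2"
  proof (cases "r = 0")
    case True
    then have "real r = 0" by simp
    then show ?thesis using zero_le_power2[of a] by linarith
  next
    case False
    have "(real r - 1) ^ 2 \<le> real r * (real r - 1)"
      using False by (simp add: power2_eq_square algebra_simps)
    also have "\<dots> = real (r * (r - 1))" using False by (simp add: of_nat_diff)
    also have "\<dots> \<le> 2 * a ^ 3" using r a3 by (metis of_nat_le_iff of_nat_mult of_nat_numeral)
    also have "\<dots> \<le> 4 * a ^ 4" using a1 power_increasing[of 3 4 a] zero_le_power[of a 4] by linarith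
    also have "\<dots> = (2 * a ^ 2) ^ 2" by (simp add: power_mult_distrib flip: power_mult)
    finally show ?thesis by (rule power2_le_imp_le) simp
  qed
  moreover have "real (z_end_opt (P @ c' @ S)) \<le> real (z_end_opt (P @ c @ S)) + real r + 1 + 2 * real N"
    using le by linarith
  ultimately show ?thesis
    using N' a1 a12 unfolding n_def[symmetric] a2 by linarith
qed

text \<open>The common form is symmetric in \<open>c\<close> and \<open>c'\<close>, so reversing an
  edit means exchanging them.\<close>

lemma single_edit_replace:
  assumes "single_edit e T T'"
  obtains P c c' S where "T = P @ c @ S" "T' = P @ c' @ S" "length c \<le> 1" "length c' \<le> 1"
  using assms
proof cases
  case (substitution a b xs ys)
  then show ?thesis using that[of xs "[a]" ys "[b]"] by simp
next
  case (insertion xs ys a)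
  then show ?thesis using that[of xs "[]" ys "[a]"] by simp
next
  case (deletion xs a ys)
  then show ?thesis using that[of xs "[a]" ys "[]"] by simp
qed

text \<open>Both directions follow from \<open>z_end_opt_edit\<close>. Backwards the text has length
  at most \<open>n + 1 \<le> 2 * n\<close>, and \<open>2 powr (2/3) \<le> 2\<close> turns
  \<open>14\<close> into \<open>28\<close>. With \<open>2 \<le> n\<close>, even a deletion leaves a
  nonempty string.\<close>

lemma single_edit_z_end_opt_diff:
  assumes "single_edit e T T'" "length T = n" "2 \<le> n"
  shows "\<bar>real (z_end_opt T') - real (z_end_opt T)\<bar> \<le> 28 * real n powr (2/3)"
proof -
  obtain P c c' S where T: "T = P @ c @ S" "T' = P @ c' @ S" and c: "length c \<le> 1" "length c' \<le> 1"
    by (rule single_edit_replace[OF assms(1)])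
  have ne: "P @ c @ S \<noteq> []" "P @ c' @ S \<noteq> []" using assms T c by auto
  have len: "real (length T') \<le> 2 * real n" using assms T c by auto
  have "real (length T') powr (2/3) \<le> (2 * real n) powr (2/3)"
    using len by (intro powr_mono2) auto
  also have "\<dots> = 2 powr (2/3) * real n powr (2/3)" by (simp add: powr_mult)
  also have "\<dots> \<le> 2 * real n powr (2/3)"
    using powr_mono[of "2/3" 1 "2::real"] by (intro mult_right_mono) auto
  finally have "real (length T') powr (2/3) \<le> 2 * real n powr (2/3)" .
  moreover have "real (z_end_opt T') \<le> real (z_end_opt T) + 14 * real n powr (2/3)"
    using z_end_opt_edit[OF c ne(1)] unfolding assms(2)[symmetric] T .
  moreover have "real (z_end_opt T) \<le> real (z_end_opt T') + 14 * real (length T') powr (2/3)"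
    using z_end_opt_edit[OF c(2,1) ne(2)] unfolding T .
  ultimately show ?thesis using powr_ge_zero[of "real n" "2/3"] by linarith
qed

theorem theorem7:
  fixes e :: edit
  shows "(\<lambda>n. real_of_int (additive_sensitivity e (z_end_opt :: 'a list \<Rightarrow> nat) n))
           \<in> O(\<lambda>n. real n powr (2/3))"
proof (rule bigoI[of _ 28])
  show "\<forall>\<^sub>F n in at_top. norm (real_of_int (additive_sensitivity e (z_end_opt :: 'a list \<Rightarrow> nat) n))
      \<le> 28 * norm (real n powr (2/3))"
    using eventually_ge_at_top[of "2 :: nat"]
  proof eventually_elim
    case (elim n)
    let ?V = "sensitivity_values e (z_end_opt :: 'a list \<Rightarrow> nat) n"
    show ?case
    proof (cases "?V = {}")
      case False
      then have "additive_sensitivity e (z_end_opt :: 'a list \<Rightarrow> nat) n \<in> ?V"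
        using Max_in[OF finite_sensitivity_values False] by (simp add: additive_sensitivity_def)
      then obtain T T' :: "'a list" where "length T = n" "single_edit e T T'"
        "additive_sensitivity e (z_end_opt :: 'a list \<Rightarrow> nat) n = int (z_end_opt T') - int (z_end_opt T)"
        by (auto simp: sensitivity_values_def)
      \<comment> \<open>Should the maximum be negative, the two-sided estimate still bounds its
        norm.\<close>
      then show ?thesis using single_edit_z_end_opt_diff[of e T T' n] elim by simp
    qed (simp add: additive_sensitivity_def)
  qed
qed

end
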